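(* Let $\varphi\in\mathcal L$ and let $\mathcal R(\varphi)=\{\alpha_1,\dots,\alpha_n\}$ be its set of resolutions. Then $\varphi\equiv_{\mathsf{InqI}}\alpha_1\sqcup\dots\sqcup\alpha_n$, i.e. for every intuitionistic Kripke model $M$ and every team $t$ in $M$, $M,t\models\varphi$ if and only if $M,t\models\alpha_1\sqcup\dots\sqcup\alpha_n$.
   Context: Fix a set $\mathcal P$ of atomic sentences. The language $\mathcal L$ is given by $\varphi::=p\mid\bot\mid\varphi\land\varphi\mid\varphi\lor\varphi\mid\varphi\to\varphi\mid\varphi\sqcup\varphi$ with $p\in\mathcal P$, where $\lor$ is standard disjunction and $\sqcup$ denotes inquisitive disjunction. An intuitionistic Kripke model is $M=\langle W,R,V\rangle$ with $W$ a set (of worlds), $R$ a partial order on $W$, and $V:W\times\mathcal P\to\{0,1\}$ such that $wRw'$ and $V(w,p)=1$ imply $V(w',p)=1$. A team is a set $t\subseteq W$; $R[w]=\{w'\mid wRw'\}$ and $R[t]=\bigcup_{w\in t}R[w]$. Support $M,t\models\varphi$ is defined by: - $M,t\models p$ iff $V(w,p)=1$ for all $w\in t$; - $M,t\models\bot$ iff $t=\emptyset$; - $M,t\models\varphi\land\psi$ iff $M,t\models\varphi$ and $M,t\models\psi$; - $M,t\models\varphi\lor\psi$ iff there are $t',t''$ with $t=t'\cup t''$, $M,t'\models\varphi$ and $M,t''\models\psi$; - $M,t\models\varphi\to\psi$ iff for all $t'\subseteq R[t]$, $M,t'\models\varphi$ implies $M,t'\models\psi$; - $M,t\models\varphi\sqcup\psi$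 iff $M,t\models\varphi$ or $M,t\models\psi$. The (finite, nonempty) set $\mathcal R(\varphi)$ of resolutions of $\varphi$ is defined by: $\mathcal R(p)=\{p\}$; $\mathcal R(\bot)=\{\bot\}$; $\mathcal R(\varphi\land\psi)=\{\alpha\land\beta\mid\alpha\in\mathcal R(\varphi),\beta\in\mathcal R(\psi)\}$; $\mathcal R(\varphi\lor\psi)=\{\alpha\lor\beta\mid\alpha\in\mathcal R(\varphi),\beta\in\mathcal R(\psi)\}$; $\mathcal R(\varphi\to\psi)=\{\bigwedge_{\alpha\in\mathcal R(\varphi)}(\alpha\to f(\alpha))\mid f:\mathcal R(\varphi)\to\mathcal R(\psi)\}$; $\mathcal R(\varphi\sqcup\psi)=\mathcal R(\varphi)\cup\mathcal R(\psi)$. Finite conjunctions and inquisitive disjunctions are formed in some fixed order and bracketing (immaterial up to equivalence). *)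

theory Defs
  imports Main "HOL-Library.FuncSet"
begin

text \<open>\<open>Or\<close> is standard disjunction, \<open>IDisj\<close> is inquisitive disjunction.\<close>

datatype 'p form =
    Atom 'p
  | Bot
  | And "'p form" "'p form"
  | Or "'p form" "'p form"
  | Imp "'p form" "'p form"
  | IDisj "'p form" "'p form"

record ('w, 'p) kripke =
  worlds :: "'w set"
  acc :: "'w rel"
  val :: "'w \<Rightarrow> 'p \<Rightarrow> bool"

text \<open>The set of worlds may be empty. The values of \<open>val\<close> outside \<open>worlds\<close> are irrelevant.\<close>

definition int_kripke_model :: "('w, 'p) kripke \<Rightarrow> bool" where
  "int_kripke_model M \<longleftrightarrow>
     partial_order_on (worlds M) (acc M) \<and>
     (\<forall>w w' p. (w, w') \<in> acc M \<longrightarrow> val M w p \<longrightarrow> val M w' p)"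

primrec supports :: "('w, 'p) kripke \<Rightarrow> 'w set \<Rightarrow> 'p form \<Rightarrow> bool" where
  "supports M t (Atom p) \<longleftrightarrow> (\<forall>w\<in>t. val M w p)"
| "supports M t Bot \<longleftrightarrow> t = {}"
| "supports M t (And \<phi> \<psi>) \<longleftrightarrow> supports M t \<phi> \<and> supports M t \<psi>"
| "supports M t (Or \<phi> \<psi>) \<longleftrightarrow>
     (\<exists>t' t''. t = t' \<union> t'' \<and> supports M t' \<phi> \<and> supports M t'' \<psi>)"
| "supports M t (Imp \<phi> \<psi>) \<longleftrightarrow>
     (\<forall>t'. t' \<subseteq> acc M `` t \<longrightarrow> supports M t' \<phi> \<longrightarrow> supports M t' \<psi>)"
| "supports M t (IDisj \<phi> \<psi>) \<longleftrightarrow> supports M t \<phi> \<or> supports M t \<psi>"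

text \<open>Iterated conjunctions and inquisitive disjunctions are bracketed to the right. The values
  on the empty list are conventional: resolution sets are never empty.\<close>

fun Conj_list :: "'p form list \<Rightarrow> 'p form" where
  "Conj_list [] = Imp Bot Bot"
| "Conj_list [\<alpha>] = \<alpha>"
| "Conj_list (\<alpha> # \<beta> # \<alpha>s) = And \<alpha> (Conj_list (\<beta> # \<alpha>s))"

fun IDisj_list :: "'p form list \<Rightarrow> 'p form" where
  "IDisj_list [] = Bot"
| "IDisj_list [\<alpha>] = \<alpha>"
| "IDisj_list (\<alpha> # \<beta> # \<alpha>s) = IDisj \<alpha> (IDisj_list (\<beta> # \<alpha>s))"

text \<open>A fixed but unspecified repetition-free enumeration of each finite set; it provides the
  order of the conjunctions that resolve an implication.\<close>

definition enumeration :: "'a set \<Rightarrow> 'a list" where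
  "enumeration A = (SOME xs. set xs = A \<and> distinct xs)"

lemma enumeration:
  assumes "finite A"
  shows "set (enumeration A) = A" and "distinct (enumeration A)"
proof -
  have "set (enumeration A) = A \<and> distinct (enumeration A)"
    unfolding enumeration_def by (rule someI_ex) (rule finite_distinct_list[OF assms])
  then show "set (enumeration A) = A" and "distinct (enumeration A)" by auto
qed

primrec resolutions :: "'p form \<Rightarrow> 'p form set" where
  "resolutions (Atom p) = {Atom p}"
| "resolutions Bot = {Bot}"
| "resolutions (And \<phi> \<psi>) = {And \<alpha> \<beta> | \<alpha> \<beta>. \<alpha> \<in> resolutions \<phi> \<and> \<beta> \<in> resolutions \<psi>}"
| "resolutions (Or \<phi> \<psi>) = {Or \<alpha> \<beta> | \<alpha> \<beta>. \<alpha> \<in> resolutions \<phi> \<and> \<beta> \<in> resolutions \<psi>}"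
| "resolutions (Imp \<phi> \<psi>) =
     {Conj_list (map (\<lambda>\<alpha>. Imp \<alpha> (f \<alpha>)) (enumeration (resolutions \<phi>))) | f.
        f \<in> resolutions \<phi> \<rightarrow>\<^sub>E resolutions \<psi>}"
| "resolutions (IDisj \<phi> \<psi>) = resolutions \<phi> \<union> resolutions \<psi>"

lemma finite_resolutions: "finite (resolutions \<phi>)"
proof (induction \<phi>)
  case (Imp \<phi> \<psi>)
  then have "finite (resolutions \<phi> \<rightarrow>\<^sub>E resolutions \<psi>)"
    by (intro finite_PiE) auto
  then show ?case by simp
qed (auto intro: finite_image_set2)

lemma resolutions_nonempty: "resolutions \<phi> \<noteq> {}"
  by (induction \<phi>) (auto simp: ex_in_conv PiE_eq_empty_iff)

end

theory Submission
  imports Defs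
begin

text \<open>Resolutions are flat: a team supports them iff each of its worlds does. Hence, if
  \<open>\<alpha>\<close> is a resolution of \<open>\<phi>\<close>, there is a largest team within \<open>R[t]\<close> that supports \<open>\<alpha>\<close>.
  If \<open>t\<close> supports \<open>\<phi> \<rightarrow> \<psi>\<close>, this team supports \<open>\<psi>\<close>, so by induction it supports a single resolution
  of \<open>\<psi>\<close>, which by persistence works for every smaller team as well. These choices for the various
  \<open>\<alpha>\<close> form the function that indexes the required resolution of \<open>\<phi> \<rightarrow> \<psi>\<close>.\<close>

lemma supports_mono:
  "supports M t \<phi> \<Longrightarrow> s \<subseteq> t \<Longrightarrow> supports M s \<phi>"
proof (induction \<phi> arbitrary: s t)
  case (Or \<phi> \<psi>)
  then obtain t1 t2 where "t = t1 \<union> t2" "supports M t1 \<phi>" "supports M t2 \<psi>" by auto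
  with Or have "s = (s \<inter> t1) \<union> (s \<inter> t2)" "supports M (s \<inter> t1) \<phi>" "supports M (s \<inter> t2) \<psi>"
    by auto
  then show ?case by (simp only: supports.simps) blast
next
  case (Imp \<phi> \<psi>)
  then show ?case by (simp, meson Image_mono order_refl subset_trans)
qed auto

lemma supports_Conj_list:
  "supports M t (Conj_list \<alpha>s) \<longleftrightarrow> (\<forall>\<alpha>\<in>set \<alpha>s. supports M t \<alpha>)"
  by (induction \<alpha>s rule: Conj_list.induct) auto

lemma supports_IDisj_list:
  "\<alpha>s \<noteq> [] \<Longrightarrow> supports M t (IDisj_list \<alpha>s) \<longleftrightarrow> (\<exists>\<alpha>\<in>set \<alpha>s. supports M t \<alpha>)"
  by (induction \<alpha>s rule: IDisj_list.induct) auto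

definition flat :: "('w, 'p) kripke \<Rightarrow> 'p form \<Rightarrow> bool" where
  "flat M \<alpha> \<longleftrightarrow> (\<forall>t. supports M t \<alpha> \<longleftrightarrow> (\<forall>w\<in>t. supports M {w} \<alpha>))"

text \<open>Persistence already passes support from a team to its singletons, so flatness reduces to
  the step from singletons to the team.\<close>

lemma flatI:
  assumes "\<And>t. \<forall>w\<in>t. supports M {w} \<alpha> \<Longrightarrow> supports M t \<alpha>"
  shows "flat M \<alpha>"
  unfolding flat_def using assms supports_mono by (metis empty_subsetI insert_subset)

lemma flatD: "flat M \<alpha> \<Longrightarrow> (\<And>w. w \<in> t \<Longrightarrow> supports M {w} \<alpha>) \<Longrightarrow> supports M t \<alpha>"
  unfolding flat_def by blast

lemma flat_And: "flat M \<alpha> \<Longrightarrow> flat M \<beta> \<Longrightarrow> flat M (And \<alpha> \<beta>)"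
  by (rule flatI) (simp, meson flatD)

text \<open>If two teams cover a singleton, one of them contains it, so by persistence each world
  alone supports a disjunct. Sorting the worlds of \<open>t\<close> by disjunct gives the required
  split.\<close>

lemma flat_Or:
  assumes "flat M \<alpha>" "flat M \<beta>"
  shows "flat M (Or \<alpha> \<beta>)"
proof (rule flatI)
  fix t assume t: "\<forall>w\<in>t. supports M {w} (Or \<alpha> \<beta>)"
  have "supports M {w} \<alpha> \<or> supports M {w} \<beta>" if "w \<in> t" for w
  proof -
    from t that obtain t1 t2
      where "{w} = t1 \<union> t2" "supports M t1 \<alpha>" "supports M t2 \<beta>" by auto
    moreover from this(1) have "{w} \<subseteq> t1 \<or> {w} \<subseteq> t2" by blast
    ultimately show ?thesis using supports_mono by blast
  qed
  then have "t = {w \<in> t. supports M {w} \<alpha>} \<union> {w \<in> t. supports M {w} \<beta>}" by auto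
  moreover have "supports M {w \<in> t. supports M {w} \<alpha>} \<alpha>" "supports M {w \<in> t. supports M {w} \<beta>} \<beta>"
    using assms by (auto intro: flatD)
  ultimately show "supports M t (Or \<alpha> \<beta>)" by (simp only: supports.simps) blast
qed

text \<open>Persistence hands the antecedent down to each \<open>{v}\<close> with \<open>v\<close>
  in \<open>s\<close>, and \<open>v\<close> is a successor of a single world of \<open>t\<close>.
  Flatness of the consequent then reassembles \<open>s\<close>.\<close>

lemma flat_Imp:
  assumes "flat M \<beta>"
  shows "flat M (Imp \<alpha> \<beta>)"
proof (rule flatI)
  fix t assume t: "\<forall>w\<in>t. supports M {w} (Imp \<alpha> \<beta>)"
  have "supports M s \<beta>" if s: "s \<subseteq> acc M `` t" "supports M s \<alpha>" for s
  proof (rule flatD[OF assms])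
    fix v assume "v \<in> s"
    with s obtain w where "w \<in> t" "{v} \<subseteq> acc M `` {w}" by blast
    moreover have "supports M {v} \<alpha>" using s(2) \<open>v \<in> s\<close> by (auto intro: supports_mono)
    ultimately show "supports M {v} \<beta>" using t by simp
  qed
  then show "supports M t (Imp \<alpha> \<beta>)" by simp
qed

lemma flat_Conj_list: "(\<And>\<alpha>. \<alpha> \<in> set \<alpha>s \<Longrightarrow> flat M \<alpha>) \<Longrightarrow> flat M (Conj_list \<alpha>s)"
  by (rule flatI) (auto simp: supports_Conj_list intro: flatD)

text \<open>Only inquisitive disjunction can break flatness, and it never occurs in a
  resolution.\<close>

lemma flat_resolution: "\<alpha> \<in> resolutions \<phi> \<Longrightarrow> flat M \<alpha>"
proof (induction \<phi> arbitrary: \<alpha>)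
  case (Imp \<phi> \<psi>)
  from Imp.prems obtain f where f: "f \<in> resolutions \<phi> \<rightarrow>\<^sub>E resolutions \<psi>"
    and \<alpha>: "\<alpha> = Conj_list (map (\<lambda>\<beta>. Imp \<beta> (f \<beta>)) (enumeration (resolutions \<phi>)))"
    by auto
  have "flat M (Imp \<beta> (f \<beta>))" if "\<beta> \<in> resolutions \<phi>" for \<beta>
    using that by (intro flat_Imp Imp.IH(2) PiE_mem[OF f])
  then show ?case
    unfolding \<alpha> by (intro flat_Conj_list) (auto simp: enumeration finite_resolutions)
qed (auto intro: flat_And flat_Or simp: flat_def[of _ "Atom _"] flat_def[of _ Bot])

lemma supports_iff_resolution:
  "supports M t \<phi> \<longleftrightarrow> (\<exists>\<alpha>\<in>resolutions \<phi>. supports M t \<alpha>)"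
proof (induction \<phi> arbitrary: t)
  case (And \<phi> \<psi>)
  then show ?case by fastforce
next
  case (Or \<phi> \<psi>)
  show ?case by (simp add: Or) (metis supports.simps(4))
next
  case (Imp \<phi> \<psi>)
  have resolution: "supports M t (Conj_list (map (\<lambda>\<alpha>. Imp \<alpha> (f \<alpha>)) (enumeration (resolutions \<phi>))))
      \<longleftrightarrow> (\<forall>\<alpha>\<in>resolutions \<phi>. supports M t (Imp \<alpha> (f \<alpha>)))" for f
    by (simp add: supports_Conj_list enumeration finite_resolutions)
  show ?case
  proof
    assume Imp_t: "supports M t (Imp \<phi> \<psi>)"
    have "\<exists>\<beta>\<in>resolutions \<psi>. supports M t (Imp \<alpha> \<beta>)" if \<alpha>: "\<alpha> \<in> resolutions \<phi>" for \<alpha>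
    proof -
      define s where "s = {w \<in> acc M `` t. supports M {w} \<alpha>}"
      have "supports M s \<alpha>" unfolding s_def using flat_resolution[OF \<alpha>] by (auto intro: flatD)
      then have "supports M s \<phi>" using \<alpha> Imp.IH(1) by blast
      then have "supports M s \<psi>" using Imp_t by (auto simp: s_def)
      then obtain \<beta> where \<beta>: "\<beta> \<in> resolutions \<psi>" "supports M s \<beta>" using Imp.IH(2) by blast
      \<comment> \<open>By persistence each world of \<open>u\<close> supports
        \<open>\<alpha>\<close> alone, so \<open>s\<close> is the largest team to test.\<close>
      have "u \<subseteq> s" if "u \<subseteq> acc M `` t" "supports M u \<alpha>" for u
        using that supports_mono[of M u \<alpha>] by (auto simp: s_def)
      then show ?thesis using \<beta> supports_mono[of M s \<beta>] by (metis supports.simps(5))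
    qed
    then obtain g where
      g: "\<forall>\<alpha>\<in>resolutions \<phi>. g \<alpha> \<in> resolutions \<psi> \<and> supports M t (Imp \<alpha> (g \<alpha>))"
      by metis
    \<comment> \<open>The choices in \<open>g\<close> are arbitrary off the resolutions of
      \<open>\<phi>\<close>; restricting makes the function extensional, as
      \<open>\<rightarrow>\<^sub>E\<close> demands.\<close>
    define f where "f = restrict g (resolutions \<phi>)"
    have "f \<in> resolutions \<phi> \<rightarrow>\<^sub>E resolutions \<psi>"
      "\<forall>\<alpha>\<in>resolutions \<phi>. supports M t (Imp \<alpha> (f \<alpha>))"
      using g by (auto simp: f_def)
    then show "\<exists>\<alpha>\<in>resolutions (Imp \<phi> \<psi>). supports M t \<alpha>"
      unfolding resolutions.simps using resolution by blast
  next
    assume "\<exists>\<alpha>\<in>resolutions (Imp \<phi> \<psi>). supports M t \<alpha>"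
    then obtain f where "f \<in> resolutions \<phi> \<rightarrow>\<^sub>E resolutions \<psi>"
      and "\<forall>\<alpha>\<in>resolutions \<phi>. supports M t (Imp \<alpha> (f \<alpha>))"
      using resolution by auto
    \<comment> \<open>A subteam of \<open>R[t]\<close> supporting \<open>\<phi>\<close> supports
      some resolution \<open>\<alpha>\<close>, hence \<open>f \<alpha>\<close>, which is a
      resolution of \<open>\<psi>\<close>.\<close>
    then show "supports M t (Imp \<phi> \<psi>)"
      by (simp add: Imp.IH) (blast dest: PiE_mem)
  qed
qed auto

theorem theorem4p9:
  fixes \<phi> :: "'p form"
    and \<alpha>s :: "'p form list"
    and M :: "('w, 'p) kripke"
    and t :: "'w set"
  assumes "set \<alpha>s = resolutions \<phi>"
    and "int_kripke_model M"
    and "t \<subseteq> worlds M"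
  shows "supports M t \<phi> \<longleftrightarrow> supports M t (IDisj_list \<alpha>s)"
proof -
  \<comment> \<open>This excludes the conventional value \<open>Bot\<close> of the empty inquisitive
    disjunction.\<close>
  have "\<alpha>s \<noteq> []" using assms(1) resolutions_nonempty[of \<phi>] by auto
  then show ?thesis using assms(1) by (simp add: supports_IDisj_list flip: supports_iff_resolution)
qed

end
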